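(* Let $\mathbb{S}$ be the set of $H$-even matrix polynomials in $\mathbb{P}_m(\mathbb{C}^{n\times n})$. Let $P\in\mathbb{S}$ be regular and let $(\lambda,x)\in\mathbb{C}\times\mathbb{C}^n$ be such that $x^Hx=1$. Set $r:=-P(\lambda)x$, $P_x:=I-xx^H$ and $\Lambda_m:=[1,\lambda,\ldots,\lambda^m]^T$. Then $$\eta_F^{\mathbb{S}}(\lambda,x,P)=\begin{cases}\dfrac{\sqrt{2\|r\|_2^2-|x^Hr|^2}}{\|\Lambda_m\|_2}\le\sqrt2\,\eta(\lambda,x,P),&\lambda\in i\mathbb{R},\\[2mm] \sqrt{\|\widehat r\|_2^2+\dfrac{2(\|r\|_2^2-|x^Hr|^2)}{\|\Lambda_m\|_2^2}},&\lambda\in\mathbb{C}\setminus i\mathbb{R},\end{cases}$$ $$\eta_2^{\mathbb{S}}(\lambda,x,P)=\begin{cases}\eta(\lambda,x,P),&\lambda\in i\mathbb{R},\\ \sqrt{\|\widehat r\|_2^2+\dfrac{\|r\|_2^2-|x^Hr|^2}{\|\Lambda_m\|_2^2}},&\lambda\in\mathbb{C}\setminus i\mathbb{R},\end{cases}$$ where $$\widehat r:=\begin{bmatrix}(\Pi_e\operatorname{Re}\Lambda_m)^T-((I-\Pi_e)\operatorname{Im}\Lambda_m)^T\\ (\Pi_e\operatorname{Im}\Lambda_m)^T+((I-\Pi_e)\operatorname{Re}\Lambda_m)^T\end{bmatrix}^\dagger\begin{bmatrix}\operatorname{re}(x^Hr)\\ \operatorname{im}(x^Hr)\end{bmatrix}\in\mathbb{R}^{m+1}.$$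 For $j=0,\ldots,m$ set $$E_j:=\frac{1}{\|\Lambda_m\|_2^2}\left[\overline{\lambda^j}P_xrx^H+\lambda^jxr^HP_x\right],\qquad F_j:=\frac{1}{\|\Lambda_m\|_2^2}\left[\overline{\lambda^j}P_xrx^H-\lambda^jxr^HP_x\right].$$ For the Frobenius norm, for $j=0,\ldots,m$ define $\Delta A_j:=\frac{\overline{\lambda^j}}{\|\Lambda_m\|_2^2}\left[xr^H+rx^H-(r^Hx)xx^H\right]$ when $\lambda\in i\mathbb{R}$, and $$\Delta A_j:=\begin{cases}e_j^T\widehat r\,xx^H+E_j,&j\text{ even},\\ i\,e_j^T\widehat r\,xx^H+F_j,&j\text{ odd},\end{cases}$$ when $\lambda\in\mathbb{C}\setminus i\mathbb{R}$. Then $\Delta P(z):=\sum_{j=0}^m z^j\Delta A_j$ is the unique $H$-even polynomial in $\mathbb{S}$ such that $P(\lambda)x+\Delta P(\lambda)x=0$ and $|||\Delta P|||_F=\eta_F^{\mathbb{S}}(\lambda,x,P)$. For the spectral norm, for $j=0,\ldots,m$ define $$\Delta A_j:=\frac{\overline{\lambda^j}}{\|\Lambda_m\|_2^2}\left[xr^H+rx^H-(r^Hx)xx^H\right]+\frac{(-1)^{j+1}\lambda^j\,x^Hr\,P_xrr^HP_x}{\|\Lambda_m\|_2^2(\|r\|_2^2-|x^Hr|^2)}$$ when $\lambda\in i\mathbb{R}$, and $$\Delta A_j:=\begin{cases}e_j^T\widehat r\,xx^H+E_j+\dfrac{(-1)^{j+1}e_j^T\widehat r\,P_xrr^HP_x}{\|r\|_2^2-|x^Hr|^2},&j\text{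 even},\\[2mm] i\,e_j^T\widehat r\,xx^H+F_j-\dfrac{i(-1)^{j+1}e_j^T\widehat r\,P_xrr^HP_x}{\|r\|_2^2-|x^Hr|^2},&j\text{ odd},\end{cases}$$ when $\lambda\in\mathbb{C}\setminus i\mathbb{R}$, where the term with denominator containing $\|r\|_2^2-|x^Hr|^2$ is taken to be $0$ if $|x^Hr|=\|r\|_2$. Then $\Delta P(z):=\sum_{j=0}^m z^j\Delta A_j$ is an $H$-even polynomial in $\mathbb{S}$ such that $P(\lambda)x+\Delta P(\lambda)x=0$ and $|||\Delta P|||_2=\eta_2^{\mathbb{S}}(\lambda,x,P)$.
   Context: $m,n\ge1$ are integers. $\mathbb{P}_m(\mathbb{C}^{n\times n})$ is the vector space of matrix polynomials $P(z)=\sum_{j=0}^m z^jA_j$ with $A_j\in\mathbb{C}^{n\times n}$ (degree at most $m$). $P$ is regular if $\det P(z)\ne0$ for some $z\in\mathbb{C}$. $P$ is $H$-even if $A_j$ is Hermitian for $j$ even (including $j=0$) and skew-Hermitian for $j$ odd. $i\mathbb{R}$ is the imaginary axis. $\Pi_e:\mathbb{C}^{m+1}\to\mathbb{C}^{m+1}$ is the even index projection: it maps $[x_0,\ldots,x_m]^T$ to the vector obtained by replacing $x_j$ by $0$ for every odd $j$ and keeping $x_j$ for every even $j$; $I-\Pi_e$ is the odd index projection. $\operatorname{Re},\operatorname{Im}$ (for vectors) and $\operatorname{re},\operatorname{im}$ (for scalars) are real and imaginary parts; $A^\dagger$ is the Moore–Penrose pseudo-inverse; $e_0,\ldots,e_m$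 is the canonical basis of $\mathbb{C}^{m+1}$; bars denote complex conjugation. For $M\in\{2,F\}$, $|||P|||_M:=\left(\sum_{j=0}^m\|A_j\|_M^2\right)^{1/2}$, where $\|\cdot\|_F$ is the Frobenius norm and $\|\cdot\|_2$ the spectral norm. For $P$ regular, $\lambda\in\mathbb{C}$ and $x\in\mathbb{C}^n$ with $x^Hx=1$, the unstructured backward error is $\eta(\lambda,x,P):=\inf\{|||\Delta P|||_M:\Delta P\in\mathbb{P}_m(\mathbb{C}^{n\times n}),\ P(\lambda)x+\Delta P(\lambda)x=0\}$, which equals $\|P(\lambda)x\|_2/\|\Lambda_m\|_2$ for both $M=2$ and $M=F$. For $P\in\mathbb{S}$ the structured backward error is $\eta_M^{\mathbb{S}}(\lambda,x,P):=\inf\{|||\Delta P|||_M:\Delta P\in\mathbb{S},\ P(\lambda)x+\Delta P(\lambda)x=0\}$. *)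

theory Defs
  imports
    "Jordan_Normal_Form.Schur_Decomposition"
    "HOL-Analysis.Analysis"
begin

(* Vectors and matrices over C of the fixed size n = CARD('n) are complex^'n and complex^'n^'n.
   The types of Jordan_Normal_Form are used only for objects whose dimension involves the
   number m (elements of C^(m+1) and 2 x (m+1) matrices); they are indexed from 0. *)
hide_const (open) Matrix.mat Matrix.vec Matrix.row Matrix.col
no_notation vec_index (infixl "$" 100)

section \<open>Complex matrices and vectors\<close>

definition cscale :: "complex \<Rightarrow> complex^'n^'n \<Rightarrow> complex^'n^'n"  (infixr "*\<^sub>C" 75)
  where "c *\<^sub>C A = (\<chi> i j. c * A $ i $ j)"

definition conj_transpose :: "complex^'n^'n \<Rightarrow> complex^'n^'n"
  where "conj_transpose A = (\<chi> i j. cnj (A $ j $ i))"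

definition hermitian :: "complex^'n^'n \<Rightarrow> bool"
  where "hermitian A \<longleftrightarrow> conj_transpose A = A"

definition skew_hermitian :: "complex^'n^'n \<Rightarrow> bool"
  where "skew_hermitian A \<longleftrightarrow> conj_transpose A = - A"

(* The scalar x^H y. *)
definition hprod :: "complex^'n \<Rightarrow> complex^'n \<Rightarrow> complex"
  where "hprod x y = (\<Sum>i\<in>UNIV. cnj (x $ i) * y $ i)"

(* The rank-one matrix x y^H. *)
definition outer :: "complex^'n \<Rightarrow> complex^'n \<Rightarrow> complex^'n^'n"
  where "outer x y = (\<chi> i j. x $ i * cnj (y $ j))"

datatype norm_kind = Spectral | Frobenius

(* The norm of complex^'n is the Euclidean norm, so onorm gives the spectral norm; the norm of
   complex^'n^'n is the Frobenius norm (see norm_eq_frobenius). *)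
fun matrix_norm :: "norm_kind \<Rightarrow> complex^'n^'n \<Rightarrow> real" where
  "matrix_norm Spectral A = onorm ((*v) A)"
| "matrix_norm Frobenius A = norm A"

lemma norm_eq_frobenius:
  fixes A :: "complex^'n^'n"
  shows "norm A = sqrt (\<Sum>i\<in>UNIV. \<Sum>j\<in>UNIV. (cmod (A $ i $ j))\<^sup>2)"
  by (simp add: norm_vec_def L2_set_def sum_nonneg)

section \<open>Matrix polynomials\<close>

(* A matrix polynomial is an element of the library type of polynomials, with matrices as
   coefficients.  The library evaluation poly would use the entrywise product of matrices and
   is therefore not usable here. *)
type_synonym 'n matrix_poly = "(complex^'n^'n) poly"

definition matrix_polys :: "nat \<Rightarrow> 'n::finite matrix_poly set"
  where "matrix_polys m = {P. degree P \<le> m}"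

definition mp_eval :: "'n::finite matrix_poly \<Rightarrow> complex \<Rightarrow> complex^'n^'n"
  where "mp_eval P z = (\<Sum>j\<le>degree P. z ^ j *\<^sub>C coeff P j)"

definition mp_regular :: "'n::finite matrix_poly \<Rightarrow> bool"
  where "mp_regular P \<longleftrightarrow> (\<exists>z. det (mp_eval P z) \<noteq> 0)"

definition H_even :: "nat \<Rightarrow> 'n::finite matrix_poly set"
  where "H_even m = {P \<in> matrix_polys m.
    \<forall>j\<le>m. if even j then hermitian (coeff P j) else skew_hermitian (coeff P j)}"

definition mp_norm :: "nat \<Rightarrow> norm_kind \<Rightarrow> 'n::finite matrix_poly \<Rightarrow> real"
  where "mp_norm m M P = sqrt (\<Sum>j\<le>m. (matrix_norm M (coeff P j))\<^sup>2)"

section \<open>Backward errors\<close>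

definition unstructured_error ::
    "nat \<Rightarrow> norm_kind \<Rightarrow> complex \<Rightarrow> complex^'n \<Rightarrow> 'n::finite matrix_poly \<Rightarrow> real"
  where "unstructured_error m M lam x P =
    Inf {mp_norm m M D | D. D \<in> matrix_polys m \<and> mp_eval P lam *v x + mp_eval D lam *v x = 0}"

definition structured_error ::
    "'n::finite matrix_poly set \<Rightarrow> nat \<Rightarrow> norm_kind \<Rightarrow> complex \<Rightarrow> complex^'n \<Rightarrow> 'n matrix_poly \<Rightarrow> real"
  where "structured_error S m M lam x P =
    Inf {mp_norm m M D | D. D \<in> S \<and> mp_eval P lam *v x + mp_eval D lam *v x = 0}"

section \<open>The vector of powers, index projections and the pseudo-inverse\<close>

definition l2norm :: "'a::real_normed_vector Matrix.vec \<Rightarrow> real"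
  where "l2norm v = sqrt (\<Sum>j<dim_vec v. (norm (vec_index v j))\<^sup>2)"

definition Lambda_vec :: "nat \<Rightarrow> complex \<Rightarrow> complex Matrix.vec"
  where "Lambda_vec m lam = Matrix.vec (m + 1) (\<lambda>j. lam ^ j)"

definition even_proj :: "'a::zero Matrix.vec \<Rightarrow> 'a Matrix.vec"
  where "even_proj v = Matrix.vec (dim_vec v) (\<lambda>j. if even j then vec_index v j else 0)"

definition odd_proj :: "'a::ab_group_add Matrix.vec \<Rightarrow> 'a Matrix.vec"
  where "odd_proj v = v - even_proj v"

(* The Moore-Penrose pseudo-inverse, characterized by the four Penrose equations. *)
definition pinv :: "'a::conjugatable_field Matrix.mat \<Rightarrow> 'a Matrix.mat"
  where "pinv A = (THE X. X \<in> carrier_mat (dim_col A) (dim_row A)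
    \<and> A * X * A = A \<and> X * A * X = X
    \<and> mat_adjoint (A * X) = A * X \<and> mat_adjoint (X * A) = X * A)"

(* The coefficient matrix and the right-hand side are those of the real linear system
   s = sum_j lam^j * (if even j then t_j else i t_j) in t_0, ..., t_m. *)
definition r_hat :: "nat \<Rightarrow> complex \<Rightarrow> complex \<Rightarrow> real Matrix.vec"
  where "r_hat m lam s =
    (let ReL = map_vec Re (Lambda_vec m lam); ImL = map_vec Im (Lambda_vec m lam)
     in pinv (mat_of_rows (m + 1) [even_proj ReL - odd_proj ImL, even_proj ImL + odd_proj ReL])
          *\<^sub>v vec_of_list [Re s, Im s])"

end

theory Submission
  imports Defs
begin

text \<open>
  A feasible polynomial is constrained only through \<open>\<Sum>j\<le>m. lam ^ j *s (A j *v x) = r\<close>. Write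
  \<open>w = P\<^sub>x r\<close>. On an \<open>H\<close>-even polynomial, the Frobenius inner product with the candidate
  \<open>a\<^sub>j x x\<^sup>H + \<mu>\<^sub>j w x\<^sup>H \<plusminus> cnj \<mu>\<^sub>j x w\<^sup>H\<close>, with \<open>\<mu>\<^sub>j\<close> proportional to \<open>cnj lam\<^sup>j\<close>,
  depends only on that sum as soon as the scalars \<open>a\<^sub>j\<close> solve the corresponding scalar least norm
  problem. Hence the candidate is orthogonal to every feasible direction, and Pythagoras gives
  minimality and uniqueness. For the spectral norm the same argument applies to the vectors
  \<open>A j *v x\<close>, whose norms bound the spectral norms from below; a multiple of \<open>w w\<^sup>H\<close> is added to
  turn the restriction of each coefficient to the span of \<open>x\<close> and \<open>w\<close> into a multiple of a unitary
  map, so that the lower bound is attained. The scalar problem is solved by the Cauchy-Schwarz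
  vector if \<open>lam\<close> is imaginary and by the pseudo-inverse otherwise.
\<close>

section \<open>Inner products and rank-one matrices\<close>

lemma hprod_add_right: "hprod x (y + z) = hprod x y + hprod x z"
  by (simp add: hprod_def algebra_simps sum.distrib)

lemma hprod_add_left: "hprod (x + y) z = hprod x z + hprod y z"
  by (simp add: hprod_def algebra_simps sum.distrib)

lemma hprod_diff_right: "hprod x (y - z) = hprod x y - hprod x z"
  by (simp add: hprod_def algebra_simps sum_subtractf)

lemma hprod_scale_right: "hprod x (c *s y) = c * hprod x y"
  by (simp add: hprod_def sum_distrib_left mult_ac)

lemma hprod_scale_left: "hprod (c *s x) y = cnj c * hprod x y"
  by (simp add: hprod_def sum_distrib_left mult_ac)

lemma hprod_zero_left [simp]: "hprod 0 y = 0"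
  by (simp add: hprod_def)

lemma hprod_zero_right [simp]: "hprod x 0 = 0"
  by (simp add: hprod_def)

lemma hprod_sum_right: "hprod x (\<Sum>j\<in>I. y j) = (\<Sum>j\<in>I. hprod x (y j))"
  by (induction I rule: infinite_finite_induct) (simp_all add: hprod_add_right)

lemma cnj_hprod: "cnj (hprod x y) = hprod y x"
  by (simp add: hprod_def mult_ac)

lemma inner_complex_eq: "inner x y = Re (cnj x * y)" for x y :: complex
  by (simp add: inner_complex_def)

lemma inner_eq_Re_hprod: "inner x y = Re (hprod x y)" for x y :: "complex^'n"
  by (simp add: inner_vec_def hprod_def inner_complex_def)

lemma hprod_self: "hprod x x = complex_of_real ((norm x)\<^sup>2)" for x :: "complex^'n"
proof -
  have "Im (hprod x x) = 0"
    by (metis cnj_hprod complex_In_mult_cnj_zero complex_cnj_cancel_iff Reals_cnj_iff complex_is_Real_iff)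
  then show ?thesis
    by (simp add: complex_eq_iff power2_norm_eq_inner inner_eq_Re_hprod)
qed

lemma norm_vector_scale: "norm (c *s x) = cmod c * norm x" for x :: "complex^'n"
  by (simp add: norm_vec_def norm_mult L2_set_right_distrib)

lemma matrix_vector_mult_cscale: "(c *\<^sub>C A) *v x = c *s (A *v x)"
  by (simp add: cscale_def matrix_vector_mult_def vec_eq_iff sum_distrib_left mult_ac)

lemma matrix_vector_mult_outer: "outer u v *v y = hprod v y *s u"
  by (simp add: outer_def matrix_vector_mult_def vec_eq_iff hprod_def sum_distrib_left mult_ac)

lemma matrix_vector_mult_sum: "(\<Sum>j\<in>I. A j) *v y = (\<Sum>j\<in>I. A j *v y)"
  for A :: "'b \<Rightarrow> complex^'n^'n"
  by (induction I rule: infinite_finite_induct) (simp_all add: matrix_vector_mult_add_rdistrib)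

lemma hprod_adjoint: "hprod u (A *v v) = hprod (conj_transpose A *v u) v"
proof -
  have "hprod u (A *v v) = (\<Sum>i\<in>UNIV. \<Sum>j\<in>UNIV. cnj (u $ i) * A $ i $ j * v $ j)"
    by (simp add: hprod_def matrix_vector_mult_def sum_distrib_left mult_ac)
  also have "\<dots> = (\<Sum>j\<in>UNIV. \<Sum>i\<in>UNIV. cnj (u $ i) * A $ i $ j * v $ j)"
    by (rule sum.swap)
  also have "\<dots> = hprod (conj_transpose A *v u) v"
    by (simp add: hprod_def matrix_vector_mult_def conj_transpose_def sum_distrib_left
        sum_distrib_right mult_ac)
  finally show ?thesis .
qed

text \<open>The real inner product of matrices is \<open>Re (trace (A^H B))\<close>, so pairing with
  a rank-one matrix reads off one value of the sesquilinear form of \<open>A\<close>. The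
  orthogonality arguments rest on this reduction.\<close>

lemma inner_cscale_outer: "inner (c *\<^sub>C outer u v) A = Re (cnj c * hprod u (A *v v))"
proof -
  have "inner (c *\<^sub>C outer u v) A
      = Re (\<Sum>i\<in>UNIV. \<Sum>j\<in>UNIV. cnj (c * (u $ i * cnj (v $ j))) * A $ i $ j)"
    by (simp add: inner_vec_def cscale_def outer_def inner_complex_eq del: complex_cnj_mult)
  also have "(\<Sum>i\<in>UNIV. \<Sum>j\<in>UNIV. cnj (c * (u $ i * cnj (v $ j))) * A $ i $ j)
      = cnj c * hprod u (A *v v)"
    by (simp add: hprod_def matrix_vector_mult_def sum_distrib_left mult_ac)
  finally show ?thesis .
qed

lemma conj_transpose_simps:
  "conj_transpose (A + B) = conj_transpose A + conj_transpose B"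
  "conj_transpose (A - B) = conj_transpose A - conj_transpose B"
  "conj_transpose (c *\<^sub>C A) = cnj c *\<^sub>C conj_transpose A"
  "conj_transpose (outer u v) = outer v u"
  "conj_transpose 0 = 0"
  by (simp_all add: conj_transpose_def vec_eq_iff cscale_def outer_def)

lemma cscale_simps:
  "c *\<^sub>C (A + B) = c *\<^sub>C A + c *\<^sub>C B"
  "c *\<^sub>C (A - B) = c *\<^sub>C A - c *\<^sub>C B"
  "(c + d) *\<^sub>C A = c *\<^sub>C A + d *\<^sub>C A"
  "c *\<^sub>C d *\<^sub>C A = (c * d) *\<^sub>C A"
  "0 *\<^sub>C A = 0"
  "c *\<^sub>C 0 = 0"
  "1 *\<^sub>C A = A"
  "(-1) *\<^sub>C A = - A"
  by (simp_all add: vec_eq_iff cscale_def algebra_simps)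

lemma norm_cscale_outer: "norm (c *\<^sub>C outer u v) = cmod c * norm u * norm v"
  for u v :: "complex^'n"
proof -
  have "(norm (c *\<^sub>C outer u v))\<^sup>2 = Re (cnj c * c * hprod v v * hprod u u)"
    by (simp add: power2_norm_eq_inner inner_cscale_outer matrix_vector_mult_cscale
        matrix_vector_mult_outer hprod_scale_right mult_ac)
  also have "\<dots> = (cmod c * norm u * norm v)\<^sup>2"
    unfolding hprod_self mult.commute[of "cnj c"] complex_norm_square[symmetric]
    by (simp add: power_mult_distrib flip: of_real_mult of_real_power)
  finally show ?thesis
    by (simp add: power2_eq_iff_nonneg)
qed

lemma bounded_linear_matrix_mult: "bounded_linear ((*v) A)" for A :: "complex^'n^'n"
proof (rule linear_conv_bounded_linear[THEN iffD1], rule linearI)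
  show "A *v (c *\<^sub>R b) = c *\<^sub>R (A *v b)" for c b
    by (simp add: matrix_vector_mult_def vec_eq_iff scaleR_sum_right)
qed (rule matrix_vector_right_distrib)

text \<open>Cauchy-Schwarz for the Frobenius inner product of \<open>A\<close> with the rank-one
  matrix built from \<open>A *v y\<close> and \<open>y\<close>.\<close>

lemma norm_matrix_vector_mult_le: "norm (A *v y) \<le> norm A * norm y" for A :: "complex^'n^'n"
proof (cases "A *v y = 0")
  case False
  have "(norm (A *v y))\<^sup>2 = inner (1 *\<^sub>C outer (A *v y) y) A"
    unfolding inner_cscale_outer by (simp add: hprod_self flip: of_real_power)
  also have "\<dots> \<le> norm (1 *\<^sub>C outer (A *v y) y) * norm A"
    by (rule norm_cauchy_schwarz)
  also have "\<dots> = norm (A *v y) * (norm A * norm y)"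
    unfolding norm_cscale_outer by simp
  finally show ?thesis using False by (simp add: power2_eq_square)
qed simp

text \<open>Together with \<open>matrix_norm_le_norm\<close> this lets one argument treat both norms
  in the unstructured problem.\<close>

lemma norm_mult_vec_le_matrix_norm: "norm (A *v y) \<le> matrix_norm M A * norm y"
  for A :: "complex^'n^'n"
  by (cases M) (simp_all add: onorm[OF bounded_linear_matrix_mult] norm_matrix_vector_mult_le)

lemma matrix_norm_le_norm: "matrix_norm M A \<le> norm A" for A :: "complex^'n^'n"
  by (cases M) (auto intro!: onorm_bound norm_matrix_vector_mult_le)

lemma matrix_norm_nonneg: "0 \<le> matrix_norm M A" for A :: "complex^'n^'n"
  by (cases M) (simp_all add: onorm_pos_le[OF bounded_linear_matrix_mult])

section \<open>Coefficients and evaluation of matrix polynomials\<close>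

lemma mp_eval_eq: "mp_eval P z = (\<Sum>j\<le>m. z ^ j *\<^sub>C coeff P j)" if "P \<in> matrix_polys m"
  unfolding mp_eval_def using that
  by (intro sum.mono_neutral_left) (auto simp: matrix_polys_def cscale_simps coeff_eq_0)

lemma coeff_sum_monom: "coeff (\<Sum>j\<le>m. monom (A j) j) i = (if i \<le> m then A i else 0)"
  by (simp add: coeff_sum flip: if_distrib)

lemma sum_monom_in_matrix_polys: "(\<Sum>j\<le>m. monom (A j) j) \<in> matrix_polys m"
  unfolding matrix_polys_def by (auto intro!: degree_le simp: coeff_sum_monom)

text \<open>A single sign \<open>(-1) ^ j\<close> covers the Hermitian and the skew-Hermitian
  coefficients, which spares most parity splits later.\<close>

lemma H_even_iff:
  "D \<in> H_even m \<longleftrightarrow> D \<in> matrix_polys m \<and> (\<forall>j\<le>m. conj_transpose (coeff D j) = (-1) ^ j *\<^sub>C coeff D j)"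
  by (auto simp: H_even_def hermitian_def skew_hermitian_def cscale_simps uminus_power_if)

section \<open>Optimal perturbations\<close>

lemma L2_set_sum_scale_le:
  fixes v :: "nat \<Rightarrow> complex^'n"
  shows "norm (\<Sum>j\<in>I. c j *s v j) \<le> L2_set (\<lambda>j. cmod (c j)) I * L2_set (\<lambda>j. norm (v j)) I"
proof -
  have "norm (\<Sum>j\<in>I. c j *s v j) \<le> (\<Sum>j\<in>I. \<bar>cmod (c j)\<bar> * \<bar>norm (v j)\<bar>)"
    by (rule sum_norm_le) (simp add: norm_vector_scale)
  also have "\<dots> \<le> L2_set (\<lambda>j. cmod (c j)) I * L2_set (\<lambda>j. norm (v j)) I"
    by (rule L2_set_mult_ineq)
  finally show ?thesis .
qed

lemma mp_eval_mult_vec: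
  "D \<in> matrix_polys m \<Longrightarrow> mp_eval D z *v x = (\<Sum>j\<le>m. z ^ j *s (coeff D j *v x))"
  by (simp add: mp_eval_eq matrix_vector_mult_sum matrix_vector_mult_cscale)

lemma mp_norm_eq_L2_set: "mp_norm m M D = L2_set (\<lambda>j. matrix_norm M (coeff D j)) {..m}"
  by (simp add: mp_norm_def L2_set_def)

lemma unit_norm: "hprod x x = 1 \<Longrightarrow> norm x = 1" for x :: "complex^'n"
  using hprod_self[of x]
  by (metis norm_ge_zero of_real_eq_1_iff power2_eq_1_iff not_one_le_zero neg_equal_0_iff_equal
      neg_0_le_iff_le)

lemma mp_norm_ge_image:
  fixes x :: "complex^'n"
  assumes "hprod x x = 1"
  shows "L2_set (\<lambda>j. norm (coeff D j *v x)) {..m} \<le> mp_norm m M D"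
  unfolding mp_norm_eq_L2_set
  using norm_mult_vec_le_matrix_norm[of "coeff D _" x M] unit_norm[OF assms]
  by (intro L2_set_mono) auto

text \<open>The Euclidean norm of the vector of powers, in the \<open>L2_set\<close> form to which
  the Cauchy-Schwarz bound refers.\<close>

definition power_norm :: "nat \<Rightarrow> complex \<Rightarrow> real"
  where "power_norm m z = L2_set (\<lambda>j. cmod (z ^ j)) {..m}"

lemma power_norm_squared: "(power_norm m z)\<^sup>2 = (\<Sum>j\<le>m. (cmod (z ^ j))\<^sup>2)"
  by (simp add: power_norm_def L2_set_def sum_nonneg)

lemma power_norm_pos: "0 < power_norm m z"
proof -
  have "cmod (z ^ 0) \<le> power_norm m z"
    unfolding power_norm_def by (rule member_le_L2_set) auto
  then show ?thesis by simp
qed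

text \<open>The weights are the equality case of Cauchy-Schwarz for this constraint, hence its least
  norm solution. They reappear as \<open>\<mu>\<close> in every minimizer.\<close>

lemma sum_cnj_power: "(\<Sum>j\<le>m. z ^ j * (cnj (z ^ j) / complex_of_real ((power_norm m z)\<^sup>2))) = 1"
proof -
  have "(\<Sum>j\<le>m. z ^ j * (cnj (z ^ j) / complex_of_real ((power_norm m z)\<^sup>2)))
      = complex_of_real (\<Sum>j\<le>m. (cmod (z ^ j))\<^sup>2) / complex_of_real ((power_norm m z)\<^sup>2)"
    by (simp add: sum_divide_distrib complex_norm_square del: complex_cnj_power of_real_power)
  then show ?thesis
    using power_norm_pos[of m z] by (simp flip: power_norm_squared)
qed

lemma l2norm_Lambda_vec: "l2norm (Lambda_vec m z) = power_norm m z"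
  by (simp add: l2norm_def Lambda_vec_def power_norm_def L2_set_def lessThan_Suc_atMost)

text \<open>The lower bound only sees the images of \<open>x\<close>. The Frobenius norms of the
  rank-one coefficients \<open>\<mu> j\<close> times \<open>r x^H\<close> already attain it, so the
  value is the same for both norms.\<close>

lemma unstructured_error_eq:
  fixes x :: "complex^'n"
  assumes x: "hprod x x = 1"
  shows "unstructured_error m M z x P = norm (mp_eval P z *v x) / power_norm m z"
proof -
  define r where "r = - (mp_eval P z *v x)"
  define \<mu> where "\<mu> j = cnj (z ^ j) / complex_of_real ((power_norm m z)\<^sup>2)" for j
  define D where "D = (\<Sum>j\<le>m. monom (\<mu> j *\<^sub>C outer r x) j)"
  have D: "D \<in> matrix_polys m" "\<And>j. j \<le> m \<Longrightarrow> coeff D j = \<mu> j *\<^sub>C outer r x"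
    by (simp_all add: D_def sum_monom_in_matrix_polys coeff_sum_monom)
  have feasible: "mp_eval P z *v x + mp_eval D z *v x = 0"
  proof -
    have "mp_eval D z *v x = (\<Sum>j\<le>m. (z ^ j * \<mu> j) *s r)"
      by (simp add: mp_eval_mult_vec[OF D(1)] D(2) matrix_vector_mult_cscale
          matrix_vector_mult_outer x)
    also have "\<dots> = (\<Sum>j\<le>m. z ^ j * \<mu> j) *s r"
      by (simp add: vec_eq_iff sum_distrib_right)
    also have "\<dots> = r"
      using sum_cnj_power[of z m] by (simp add: \<mu>_def)
    finally show ?thesis by (simp add: r_def)
  qed
  have lower: "norm r / power_norm m z \<le> mp_norm m M D'"
    if "D' \<in> matrix_polys m" "mp_eval P z *v x + mp_eval D' z *v x = 0" for D'
  proof -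
    have "mp_eval D' z *v x = r"
      using that(2) by (simp add: r_def eq_neg_iff_add_eq_0 add.commute)
    then have "norm r \<le> power_norm m z * L2_set (\<lambda>j. norm (coeff D' j *v x)) {..m}"
      using L2_set_sum_scale_le[of "\<lambda>j. z ^ j" "\<lambda>j. coeff D' j *v x" "{..m}"]
      by (simp add: mp_eval_mult_vec[OF that(1)] power_norm_def)
    also have "\<dots> \<le> power_norm m z * mp_norm m M D'"
      using mp_norm_ge_image[OF x] power_norm_pos[of m z] by (intro mult_left_mono) auto
    finally show ?thesis
      using power_norm_pos[of m z] by (simp add: divide_le_eq mult.commute)
  qed
  have "mp_norm m M D \<le> L2_set (\<lambda>j. cmod (z ^ j) * (norm r / (power_norm m z)\<^sup>2)) {..m}"
    unfolding mp_norm_eq_L2_set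
  proof (rule L2_set_mono)
    fix j assume "j \<in> {..m}"
    then show "matrix_norm M (coeff D j) \<le> cmod (z ^ j) * (norm r / (power_norm m z)\<^sup>2)"
      using matrix_norm_le_norm[of M "\<mu> j *\<^sub>C outer r x"]
      by (simp add: D norm_cscale_outer unit_norm[OF x] \<mu>_def norm_divide norm_power)
  qed (rule matrix_norm_nonneg)
  also have "\<dots> = norm r / power_norm m z"
    using power_norm_pos[of m z]
    by (subst L2_set_left_distrib[symmetric]) (simp_all add: power2_eq_square flip: power_norm_def)
  finally have "mp_norm m M D \<le> norm r / power_norm m z" .
  then have value_D: "mp_norm m M D = norm r / power_norm m z"
    using lower[OF D(1) feasible] by simp
  have "unstructured_error m M z x P = norm r / power_norm m z"
    unfolding unstructured_error_def
    by (rule cInf_eq_minimum) (use value_D D(1) feasible lower in \<open>auto intro!: exI[of _ D]\<close>)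
  then show ?thesis by (simp add: r_def)
qed

text \<open>For \<open>u = v\<close> the form is real for even \<open>j\<close> and purely imaginary
  for odd \<open>j\<close>; for different vectors the two mixed values determine each other.\<close>

lemma hprod_graded_hermitian:
  assumes "conj_transpose M = (-1) ^ j *\<^sub>C M"
  shows "hprod u (M *v v) = (-1) ^ j * cnj (hprod v (M *v u))"
  unfolding hprod_adjoint[of u] assms matrix_vector_mult_cscale hprod_scale_left cnj_hprod
  by simp

text \<open>Among the solutions \<open>b\<close> of \<open>\<Sum>j\<le>m. lam ^ j * b j = hprod x r\<close> with
  \<open>cnj (b j) = (-1) ^ j * b j\<close>, the last assumption singles out the one of least norm;
  \<open>\<gamma>\<close> is the Lagrange multiplier.\<close>

locale minimal_coefficients =
  fixes m :: nat and lam :: complex and x r :: "complex^'n"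
    and a :: "nat \<Rightarrow> complex" and \<gamma> :: complex
  assumes unit: "hprod x x = 1"
    and graded: "cnj (a j) = (-1) ^ j * a j"
    and interpolates: "(\<Sum>j\<le>m. lam ^ j * a j) = hprod x r"
    and stationary: "\<lbrakk>j \<le> m; cnj b = (-1) ^ j * b\<rbrakk> \<Longrightarrow> Re (cnj (a j) * b) = Re (\<gamma> * (lam ^ j * b))"
begin

section \<open>The candidate coefficients and their action on \<open>x\<close>\<close>

definition w :: "complex^'n"
  where "w = r - hprod x r *s x"

definition \<mu> :: "nat \<Rightarrow> complex"
  where "\<mu> j = cnj (lam ^ j) / complex_of_real ((power_norm m lam)\<^sup>2)"

text \<open>The sign in the third term makes the mixed part graded. The entry \<open>c j\<close> is
  free: it is \<open>0\<close> for the Frobenius norm and balances \<open>a j\<close> for the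
  spectral norm.\<close>

definition coef :: "(nat \<Rightarrow> complex) \<Rightarrow> nat \<Rightarrow> complex^'n^'n"
  where "coef c j = a j *\<^sub>C outer x x + \<mu> j *\<^sub>C outer w x + ((-1) ^ j * cnj (\<mu> j)) *\<^sub>C outer x w
    + c j *\<^sub>C outer w w"

definition image_x :: "nat \<Rightarrow> complex^'n"
  where "image_x j = a j *s x + \<mu> j *s w"

lemma hprod_x_w: "hprod x w = 0"
  by (simp add: w_def hprod_diff_right hprod_scale_right unit)

lemma hprod_w_x: "hprod w x = 0"
  using hprod_x_w cnj_hprod[of x w] by simp

lemma hprod_w_r: "hprod w r = complex_of_real ((norm w)\<^sup>2)"
proof -
  have "r = w + hprod x r *s x" by (simp add: w_def)
  then have "hprod w r = hprod w w + hprod x r * hprod w x"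
    by (metis hprod_add_right hprod_scale_right)
  then show ?thesis by (simp add: hprod_w_x hprod_self)
qed

lemma norm_combination: "(norm (p *s x + q *s w))\<^sup>2 = (cmod p)\<^sup>2 + (cmod q)\<^sup>2 * (norm w)\<^sup>2"
proof -
  have "complex_of_real ((norm (p *s x + q *s w))\<^sup>2)
      = complex_of_real ((cmod p)\<^sup>2 + (cmod q)\<^sup>2 * (norm w)\<^sup>2)"
    unfolding hprod_self[symmetric] of_real_add of_real_mult complex_norm_square
    by (simp add: hprod_add_left hprod_add_right hprod_scale_left hprod_scale_right
        unit hprod_w_x hprod_x_w mult_ac)
  then show ?thesis by (simp only: of_real_eq_iff)
qed

lemma norm_w: "(norm w)\<^sup>2 = (norm r)\<^sup>2 - (cmod (hprod x r))\<^sup>2"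
  using norm_combination[of "hprod x r" 1] by (simp add: w_def)

text \<open>The terms ending in \<open>w^H\<close> annihilate \<open>x\<close>, so feasibility does
  not depend on \<open>c\<close>.\<close>

lemma coef_mult_x: "coef c j *v x = image_x j"
  by (simp add: coef_def image_x_def matrix_vector_mult_add_rdistrib matrix_vector_mult_cscale
      matrix_vector_mult_outer unit hprod_w_x)

lemma conj_transpose_coef:
  "cnj (c j) = (-1) ^ j * c j \<Longrightarrow> conj_transpose (coef c j) = (-1) ^ j *\<^sub>C coef c j"
  by (simp add: coef_def conj_transpose_simps cscale_simps graded flip: mult.assoc power_mult_distrib)

text \<open>The \<open>x\<close>-part sums by \<open>interpolates\<close>, the \<open>w\<close>-part
  by \<open>sum_cnj_power\<close>.\<close>

lemma sum_image_x: "(\<Sum>j\<le>m. lam ^ j *s image_x j) = r"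
proof -
  have "(\<Sum>j\<le>m. lam ^ j *s image_x j)
      = (\<Sum>j\<le>m. lam ^ j * a j) *s x + (\<Sum>j\<le>m. lam ^ j * \<mu> j) *s w"
    by (simp add: image_x_def vec_eq_iff algebra_simps sum.distrib sum_distrib_left)
  also have "\<dots> = r"
    using sum_cnj_power[of lam m] by (simp add: interpolates \<mu>_def w_def)
  finally show ?thesis .
qed

text \<open>The next three facts are the optimality condition: since both pairings only see
  \<open>\<Sum>j\<le>m. lam ^ j *s (M j *v x)\<close>, the minimizer is orthogonal to every feasible direction.\<close>

lemma inner_image_x:
  assumes "conj_transpose M = (-1) ^ j *\<^sub>C M" "j \<le> m"
  shows "inner (image_x j) (M *v x) = Re (\<gamma> * (lam ^ j * hprod x (M *v x)))
    + Re (lam ^ j * hprod w (M *v x)) / (power_norm m lam)\<^sup>2"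
proof -
  \<comment> \<open>The grading of \<open>M\<close> gives its quadratic form the symmetry under
    which \<open>stationary\<close> applies.\<close>
  have "cnj (hprod x (M *v x)) = (-1) ^ j * hprod x (M *v x)"
    by (subst (2) hprod_graded_hermitian[OF assms(1)]) (simp flip: mult.assoc power_mult_distrib)
  then have "Re (cnj (a j) * hprod x (M *v x)) = Re (\<gamma> * (lam ^ j * hprod x (M *v x)))"
    by (rule stationary[OF assms(2)])
  moreover have "Re (cnj (\<mu> j) * hprod w (M *v x))
      = Re (lam ^ j * hprod w (M *v x)) / (power_norm m lam)\<^sup>2"
    by (simp add: \<mu>_def flip: of_real_power)
  ultimately show ?thesis
    by (simp add: image_x_def inner_eq_Re_hprod hprod_add_left hprod_scale_left)
qed

lemma inner_coef:
  assumes "conj_transpose M = (-1) ^ j *\<^sub>C M" "j \<le> m"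
  shows "inner (coef (\<lambda>_. 0) j) M = Re (\<gamma> * (lam ^ j * hprod x (M *v x)))
    + 2 * (Re (lam ^ j * hprod w (M *v x)) / (power_norm m lam)\<^sup>2)"
proof -
  \<comment> \<open>The \<open>x w^H\<close> term contributes the same real part as the
    \<open>w x^H\<close> term. This doubling separates the Frobenius value from the spectral
    one.\<close>
  have "Re (cnj ((-1) ^ j * cnj (\<mu> j)) * hprod x (M *v w))
      = Re (cnj (\<mu> j) * hprod w (M *v x))"
    by (subst hprod_graded_hermitian[OF assms(1)]) (cases "even j"; simp)
  also have "\<dots> = Re (lam ^ j * hprod w (M *v x)) / (power_norm m lam)\<^sup>2"
    by (simp add: \<mu>_def flip: of_real_power)
  finally have cross: "Re (cnj ((-1) ^ j * cnj (\<mu> j)) * hprod x (M *v w))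
      = Re (lam ^ j * hprod w (M *v x)) / (power_norm m lam)\<^sup>2" .
  have "inner (coef (\<lambda>_. 0) j) M
      = inner (image_x j) (M *v x) + Re (cnj ((-1) ^ j * cnj (\<mu> j)) * hprod x (M *v w))"
    unfolding coef_def image_x_def
    by (simp add: inner_add_left inner_cscale_outer inner_eq_Re_hprod hprod_add_left
        hprod_scale_left cscale_simps)
  then show ?thesis
    unfolding cross inner_image_x[OF assms] by simp
qed

lemma sum_inner:
  assumes "\<And>j. j \<le> m \<Longrightarrow> conj_transpose (M j) = (-1) ^ j *\<^sub>C M j"
    and "(\<Sum>j\<le>m. lam ^ j *s (M j *v x)) = v"
  shows "(\<Sum>j\<le>m. inner (image_x j) (M j *v x))
      = Re (\<gamma> * hprod x v) + Re (hprod w v) / (power_norm m lam)\<^sup>2"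
    and "(\<Sum>j\<le>m. inner (coef (\<lambda>_. 0) j) (M j))
      = Re (\<gamma> * hprod x v) + 2 * (Re (hprod w v) / (power_norm m lam)\<^sup>2)"
  by (simp_all add: assms(1) inner_image_x inner_coef sum.distrib hprod_sum_right hprod_scale_right
      sum_distrib_left sum_divide_distrib flip: assms(2))

text \<open>Test \<open>stationary\<close> with \<open>a j\<close> itself and sum over
  \<open>j\<close>.\<close>

lemma Re_gamma: "Re (\<gamma> * hprod x r) = (\<Sum>j\<le>m. (cmod (a j))\<^sup>2)"
proof -
  have "Re (cnj (a j) * a j) = (cmod (a j))\<^sup>2" for j
    by (simp add: cmod_power2 flip: power2_eq_square)
  then have "(\<Sum>j\<le>m. (cmod (a j))\<^sup>2) = (\<Sum>j\<le>m. Re (\<gamma> * (lam ^ j * a j)))"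
    by (metis (no_types, lifting) sum.cong atMost_iff stationary graded)
  then show ?thesis
    by (simp add: sum_distrib_left flip: interpolates)
qed

text \<open>The candidate is itself graded and feasible, so \<open>sum_inner\<close> applied to it
  yields its own squared norm; likewise in \<open>sum_norm_coef\<close>.\<close>

lemma sum_norm_image_x:
  "(\<Sum>j\<le>m. (norm (image_x j))\<^sup>2)
    = (\<Sum>j\<le>m. (cmod (a j))\<^sup>2) + (norm w)\<^sup>2 / (power_norm m lam)\<^sup>2"
  using sum_inner(1)[of "coef (\<lambda>_. 0)" r]
  by (simp add: conj_transpose_coef coef_mult_x sum_image_x Re_gamma hprod_w_r del: times_complex.sel
      add: power2_norm_eq_inner[of "image_x _"])

lemma sum_norm_coef:
  "(\<Sum>j\<le>m. (norm (coef (\<lambda>_. 0) j))\<^sup>2)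
    = (\<Sum>j\<le>m. (cmod (a j))\<^sup>2) + 2 * ((norm w)\<^sup>2 / (power_norm m lam)\<^sup>2)"
  using sum_inner(2)[of "coef (\<lambda>_. 0)" r]
  by (simp add: conj_transpose_coef coef_mult_x sum_image_x Re_gamma hprod_w_r del: times_complex.sel
      add: power2_norm_eq_inner[of "coef _ _"])

section \<open>Comparison with an arbitrary feasible polynomial\<close>

context
  fixes D :: "'n matrix_poly"
  assumes D: "D \<in> H_even m" and feasible: "mp_eval D lam *v x = r"
begin

lemma graded_diff:
  "j \<le> m \<Longrightarrow> conj_transpose (coeff D j - coef (\<lambda>_. 0) j) = (-1) ^ j *\<^sub>C (coeff D j - coef (\<lambda>_. 0) j)"
  using D by (simp add: H_even_iff conj_transpose_simps conj_transpose_coef cscale_simps)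

lemma sum_diff: "(\<Sum>j\<le>m. lam ^ j *s ((coeff D j - coef (\<lambda>_. 0) j) *v x)) = 0"
proof -
  have "D \<in> matrix_polys m" using D by (simp add: H_even_iff)
  from feasible[unfolded mp_eval_mult_vec[OF this]]
  show ?thesis
    by (simp add: matrix_vector_mult_diff_rdistrib coef_mult_x vector_sub_rdistrib
        vector_ssub_ldistrib sum_subtractf sum_image_x)
qed

text \<open>The difference is graded and its weighted images of \<open>x\<close> sum to zero, so the
  cross terms cancel in total. The remainder is kept because its vanishing gives uniqueness.\<close>

lemma pythagoras_frobenius:
  "(\<Sum>j\<le>m. (norm (coeff D j))\<^sup>2)
    = (\<Sum>j\<le>m. (norm (coef (\<lambda>_. 0) j))\<^sup>2) + (\<Sum>j\<le>m. (norm (coeff D j - coef (\<lambda>_. 0) j))\<^sup>2)"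
proof -
  have "(norm (coeff D j))\<^sup>2 = (norm (coef (\<lambda>_. 0) j))\<^sup>2 + (norm (coeff D j - coef (\<lambda>_. 0) j))\<^sup>2
      + 2 * inner (coef (\<lambda>_. 0) j) (coeff D j - coef (\<lambda>_. 0) j)" for j
    unfolding power2_norm_eq_inner by (simp add: inner_diff_left inner_diff_right inner_commute)
  then show ?thesis
    using sum_inner(2)[OF graded_diff sum_diff]
    by (simp add: sum.distrib flip: sum_distrib_left)
qed

lemma sum_norm_image_x_le:
  "(\<Sum>j\<le>m. (norm (image_x j))\<^sup>2) \<le> (\<Sum>j\<le>m. (norm (coeff D j *v x))\<^sup>2)"
proof -
  have "(norm (coeff D j *v x))\<^sup>2 = (norm (image_x j))\<^sup>2
      + (norm ((coeff D j - coef (\<lambda>_. 0) j) *v x))\<^sup>2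
      + 2 * inner (image_x j) ((coeff D j - coef (\<lambda>_. 0) j) *v x)" for j
    unfolding power2_norm_eq_inner
    by (simp add: matrix_vector_mult_diff_rdistrib coef_mult_x inner_diff_left inner_diff_right
        inner_commute)
  then show ?thesis
    using sum_inner(1)[OF graded_diff sum_diff]
    by (simp add: sum.distrib sum_nonneg flip: sum_distrib_left)
qed

end

text \<open>With this choice of \<open>c\<close> (Davis, Kahan, Weinberger) the cross terms in the norm of
  \<open>coef c j *v y\<close> cancel. If \<open>w = 0\<close> then \<open>c j\<close> is \<open>0\<close> by division by zero.\<close>

lemma norm_completion_mult_le:
  assumes c: "c j = (-1) ^ (j + 1) * cnj (a j) / complex_of_real ((norm w)\<^sup>2)"
  shows "norm (coef c j *v y) \<le> norm (image_x j) * norm y"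
proof -
  define N where "N = (norm w)\<^sup>2"
  define \<alpha> \<beta> where "\<alpha> = hprod x y" and "\<beta> = hprod w y"
  have \<beta>0: "\<beta> = 0" if "N = 0"
    using that by (simp add: N_def \<beta>_def)
  define p q where "p = a j * \<alpha> + (-1) ^ j * cnj (\<mu> j) * \<beta>" and "q = \<mu> j * \<alpha> + c j * \<beta>"
  have "coef c j *v y = p *s x + q *s w"
    by (simp add: coef_def p_def q_def \<alpha>_def \<beta>_def matrix_vector_mult_add_rdistrib
        matrix_vector_mult_cscale matrix_vector_mult_outer vec_eq_iff algebra_simps)
  then have "(norm (coef c j *v y))\<^sup>2 = (cmod p)\<^sup>2 + (cmod q)\<^sup>2 * N"
    by (simp add: norm_combination N_def)
  \<comment> \<open>For \<open>N = 0\<close> also \<open>\<beta> = 0\<close>, and the quotient by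
    \<open>N\<close> is \<open>0\<close>, so the formula covers the degenerate case.\<close>
  also have "\<dots> = ((cmod (a j))\<^sup>2 + (cmod (\<mu> j))\<^sup>2 * N) * ((cmod \<alpha>)\<^sup>2 + (cmod \<beta>)\<^sup>2 / N)"
  proof (cases "N = 0")
    case True
    then show ?thesis by (simp add: \<beta>0 p_def norm_mult power_mult_distrib)
  next
    case False
    have "complex_of_real ((cmod p)\<^sup>2 + (cmod q)\<^sup>2 * N) = complex_of_real
      (((cmod (a j))\<^sup>2 + (cmod (\<mu> j))\<^sup>2 * N) * ((cmod \<alpha>)\<^sup>2 + (cmod \<beta>)\<^sup>2 / N))"
      unfolding of_real_add of_real_mult of_real_divide complex_norm_square p_def q_def c
        N_def[symmetric]
      using False by (cases "even j") (simp_all add: field_simps)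
    then show ?thesis by (simp only: of_real_eq_iff)
  qed
  also have "\<dots> = (norm (image_x j))\<^sup>2 * ((cmod \<alpha>)\<^sup>2 + (cmod \<beta>)\<^sup>2 / N)"
    by (simp add: image_x_def norm_combination N_def)
  also have "\<dots> \<le> (norm (image_x j))\<^sup>2 * (norm y)\<^sup>2"
  proof (rule mult_left_mono)
    \<comment> \<open>The orthogonal projection of \<open>y\<close> onto the span of
      \<open>x\<close> and \<open>w\<close>; the claim is Bessel's inequality.\<close>
    define u where "u = \<alpha> *s x + (\<beta> / complex_of_real N) *s w"
    have u: "(norm u)\<^sup>2 = (cmod \<alpha>)\<^sup>2 + (cmod \<beta>)\<^sup>2 / N"
      unfolding u_def norm_combination N_def[symmetric]
      by (cases "N = 0") (simp_all add: norm_divide power_divide power2_eq_square)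
    have "inner u y = Re (cnj \<alpha> * \<alpha> + cnj (\<beta> / complex_of_real N) * \<beta>)"
      by (simp add: u_def inner_eq_Re_hprod hprod_add_left hprod_scale_left \<alpha>_def \<beta>_def)
    also have "\<dots> = (norm u)\<^sup>2"
      unfolding u by (simp add: cmod_power2 add_divide_distrib flip: power2_eq_square)
    finally have "(norm u)\<^sup>2 \<le> norm u * norm y"
      using norm_cauchy_schwarz[of u y] by simp
    then have "norm u \<le> norm y"
      by (cases "u = 0") (simp_all add: power2_eq_square)
    then show "(cmod \<alpha>)\<^sup>2 + (cmod \<beta>)\<^sup>2 / N \<le> (norm y)\<^sup>2"
      unfolding u[symmetric] by (simp add: power_mono)
  qed simp
  finally show ?thesis
    by (simp add: power_mult_distrib[symmetric] power2_le_iff_abs_le)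
qed

section \<open>The candidate as a polynomial attaining the infimum\<close>

context
  fixes P :: "'n matrix_poly" and M :: norm_kind and c :: "nat \<Rightarrow> complex" and D :: "'n matrix_poly"
  assumes residual: "r = - (mp_eval P lam *v x)"
    and c: "\<And>j. cnj (c j) = (-1) ^ j * c j"
    and D: "D = (\<Sum>j\<le>m. monom (coef c j) j)"
begin

lemma feasible_iff: "mp_eval P lam *v x + mp_eval D' lam *v x = 0 \<longleftrightarrow> mp_eval D' lam *v x = r"
  unfolding residual by (auto simp: eq_neg_iff_add_eq_0 add.commute)

lemma minimizer_in_H_even: "D \<in> H_even m"
  by (simp add: H_even_iff D sum_monom_in_matrix_polys coeff_sum_monom conj_transpose_coef c)

lemma minimizer_feasible: "mp_eval P lam *v x + mp_eval D lam *v x = 0"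
  unfolding feasible_iff
  by (simp add: D mp_eval_mult_vec[OF sum_monom_in_matrix_polys] coeff_sum_monom coef_mult_x sum_image_x)

lemma structured_error_eqI:
  assumes "\<And>D'. \<lbrakk>D' \<in> H_even m; mp_eval D' lam *v x = r\<rbrakk> \<Longrightarrow> mp_norm m M D \<le> mp_norm m M D'"
  shows "structured_error (H_even m) m M lam x P = mp_norm m M D"
  unfolding structured_error_def
  by (rule cInf_eq_minimum)
    (use assms minimizer_in_H_even minimizer_feasible in \<open>auto simp: feasible_iff\<close>)

end

section \<open>Minimality and uniqueness in the Frobenius norm\<close>

context
  fixes P D :: "'n matrix_poly"
  assumes residual: "r = - (mp_eval P lam *v x)"
    and D: "D = (\<Sum>j\<le>m. monom (coef (\<lambda>_. 0) j) j)"
begin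

lemma mp_norm_frobenius_minimizer:
  "mp_norm m Frobenius D = sqrt ((\<Sum>j\<le>m. (cmod (a j))\<^sup>2) + 2 * ((norm w)\<^sup>2 / (power_norm m lam)\<^sup>2))"
  by (simp add: mp_norm_def D coeff_sum_monom sum_norm_coef)

lemma structured_error_frobenius:
  "structured_error (H_even m) m Frobenius lam x P = mp_norm m Frobenius D"
proof (rule structured_error_eqI[OF residual _ D])
  fix D' assume "D' \<in> H_even m" "mp_eval D' lam *v x = r"
  from pythagoras_frobenius[OF this]
  show "mp_norm m Frobenius D \<le> mp_norm m Frobenius D'"
    by (simp add: mp_norm_def D coeff_sum_monom sum_nonneg)
qed simp

lemma frobenius_minimizer_unique:
  assumes D': "D' \<in> H_even m" "mp_eval P lam *v x + mp_eval D' lam *v x = 0"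
    and "mp_norm m Frobenius D' = structured_error (H_even m) m Frobenius lam x P"
  shows "D' = D"
proof (rule poly_eqI)
  fix j
  have "mp_eval D' lam *v x = r"
    using D'(2) feasible_iff[OF residual _ D] by simp
  from pythagoras_frobenius[OF D'(1) this]
  have "(\<Sum>j\<le>m. (norm (coeff D' j - coef (\<lambda>_. 0) j))\<^sup>2) = 0"
    using assms(3) by (simp add: structured_error_frobenius mp_norm_def D coeff_sum_monom)
  then have "coeff D' j = coef (\<lambda>_. 0) j" if "j \<le> m"
    using that by (simp add: sum_nonneg_eq_0_iff)
  moreover have "coeff D' j = 0" if "\<not> j \<le> m"
    using that D'(1) by (simp add: H_even_iff matrix_polys_def coeff_eq_0)
  ultimately show "coeff D' j = coeff D j"
    by (simp add: D coeff_sum_monom)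
qed

lemma frobenius_minimizer:
  "D \<in> H_even m \<and> mp_eval P lam *v x + mp_eval D lam *v x = 0
    \<and> mp_norm m Frobenius D = structured_error (H_even m) m Frobenius lam x P
    \<and> (\<forall>D'\<in>H_even m. mp_eval P lam *v x + mp_eval D' lam *v x = 0
        \<and> mp_norm m Frobenius D' = structured_error (H_even m) m Frobenius lam x P \<longrightarrow> D' = D)"
proof (intro conjI ballI impI)
  show "D \<in> H_even m"
    by (rule minimizer_in_H_even[OF residual _ D]) simp
  show "mp_eval P lam *v x + mp_eval D lam *v x = 0"
    by (rule minimizer_feasible[OF residual _ D]) simp
qed (simp_all only: structured_error_frobenius frobenius_minimizer_unique)

end

section \<open>Minimality in the spectral norm\<close>

context
  fixes P D :: "'n matrix_poly" and c :: "nat \<Rightarrow> complex"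
  assumes residual: "r = - (mp_eval P lam *v x)"
    and c: "\<And>j. c j = (-1) ^ (j + 1) * cnj (a j) / complex_of_real ((norm w)\<^sup>2)"
    and D: "D = (\<Sum>j\<le>m. monom (coef c j) j)"
begin

lemma graded_completion: "cnj (c j) = (-1) ^ j * c j"
  by (simp add: c graded)

lemma mp_norm_spectral_minimizer_le:
  "mp_norm m Spectral D \<le> sqrt (\<Sum>j\<le>m. (norm (image_x j))\<^sup>2)"
proof -
  have "matrix_norm Spectral (coef c j) \<le> norm (image_x j)" for j
    unfolding matrix_norm.simps by (intro onorm_bound norm_completion_mult_le[of c, OF c]) simp
  then show ?thesis
    unfolding mp_norm_def D
    by (intro real_sqrt_le_mono sum_mono) (simp add: coeff_sum_monom power_mono matrix_norm_nonneg del: matrix_norm.simps)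
qed

lemma spectral_lower_bound:
  assumes "D' \<in> H_even m" "mp_eval D' lam *v x = r"
  shows "sqrt (\<Sum>j\<le>m. (norm (image_x j))\<^sup>2) \<le> mp_norm m Spectral D'"
  using sum_norm_image_x_le[OF assms] mp_norm_ge_image[OF unit, of D' m Spectral]
  unfolding L2_set_def by (meson order_trans real_sqrt_le_mono)

lemma structured_error_spectral:
  "structured_error (H_even m) m Spectral lam x P = mp_norm m Spectral D"
  by (intro structured_error_eqI[OF residual graded_completion D]
      order_trans[OF mp_norm_spectral_minimizer_le spectral_lower_bound])

text \<open>The minimizer is feasible, so the lower bound applies to it as well and meets the upper
  bound from the completion.\<close>

lemma mp_norm_spectral_minimizer:
  "mp_norm m Spectral D = sqrt ((\<Sum>j\<le>m. (cmod (a j))\<^sup>2) + (norm w)\<^sup>2 / (power_norm m lam)\<^sup>2)"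
  unfolding sum_norm_image_x[symmetric]
  using mp_norm_spectral_minimizer_le spectral_lower_bound[OF minimizer_in_H_even[OF residual graded_completion D]]
    minimizer_feasible[OF residual graded_completion D]
  by (simp add: feasible_iff[OF residual graded_completion D] order_antisym)

lemma spectral_minimizer:
  "D \<in> H_even m \<and> mp_eval P lam *v x + mp_eval D lam *v x = 0
    \<and> mp_norm m Spectral D = structured_error (H_even m) m Spectral lam x P"
  using minimizer_in_H_even[OF residual graded_completion D]
    minimizer_feasible[OF residual graded_completion D] structured_error_spectral
  by simp

end

end

section \<open>The pseudo-inverse of a matrix with two rows\<close>

lemma mat_adjoint_real: "mat_adjoint A = transpose_mat A" for A :: "real Matrix.mat"
  by (rule eq_matI) (auto simp: mat_adjoint_def mat_of_rows_def)

text \<open>Penrose's uniqueness argument: absorbing by \<open>A Y A = A\<close> and transposing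
  symmetric products gives \<open>A X = A Y\<close> and \<open>X A = Y A\<close>, whence
  \<open>X = X A X = Y A Y = Y\<close>.\<close>

lemma pinv_eqI:
  fixes A X :: "real Matrix.mat"
  assumes A: "A \<in> carrier_mat k l" and X: "X \<in> carrier_mat l k"
    and AXA: "A * X * A = A" and XAX: "X * A * X = X"
    and AX: "transpose_mat (A * X) = A * X" and XA: "transpose_mat (X * A) = X * A"
  shows "pinv A = X"
  unfolding pinv_def mat_adjoint_real
proof (rule the_equality)
  fix Y assume "Y \<in> carrier_mat (dim_col A) (dim_row A) \<and> A * Y * A = A \<and> Y * A * Y = Y
    \<and> transpose_mat (A * Y) = A * Y \<and> transpose_mat (Y * A) = Y * A"
  with A have Y: "Y \<in> carrier_mat l k" and AYA: "A * Y * A = A" and YAY: "Y * A * Y = Y"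
    and AY: "transpose_mat (A * Y) = A * Y" and YA: "transpose_mat (Y * A) = Y * A"
    by auto
  note carriers = A X Y mult_carrier_mat[OF A X] mult_carrier_mat[OF A Y]
    mult_carrier_mat[OF X A] mult_carrier_mat[OF Y A]
  have "A * X = (A * Y) * (A * X)"
    using carriers AYA by (metis assoc_mult_mat)
  then have "A * X = (A * X) * (A * Y)"
    using carriers AX AY by (metis transpose_mult)
  also have "\<dots> = A * Y"
    using carriers AXA by (metis assoc_mult_mat)
  finally have left: "A * X = A * Y" .
  have "X * A = (X * A) * (Y * A)"
    using carriers AYA by (metis assoc_mult_mat)
  then have "X * A = (Y * A) * (X * A)"
    using carriers XA YA by (metis transpose_mult)
  also have "\<dots> = Y * A"
    using carriers AXA by (metis assoc_mult_mat)
  finally have right: "X * A = Y * A" .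
  show "Y = X"
    using carriers left right XAX YAY by (metis assoc_mult_mat)
qed (use assms in auto)

lemma pinv_full_row_rank:
  fixes A G :: "real Matrix.mat"
  assumes A: "A \<in> carrier_mat k l" and G: "G \<in> carrier_mat k k"
    and inverse: "A * transpose_mat A * G = 1\<^sub>m k"
  shows "pinv A = transpose_mat A * G"
proof -
  have At: "transpose_mat A \<in> carrier_mat l k" using A by simp
  note AAt = mult_carrier_mat[OF A At]
  note X = mult_carrier_mat[OF At G]
  have AX: "A * (transpose_mat A * G) = 1\<^sub>m k"
    using A At G inverse by (metis assoc_mult_mat)
  \<comment> \<open>Since the Gram matrix is symmetric, its right inverse \<open>G\<close> is also a
    left inverse after transposition, hence symmetric. The symmetry of \<open>X * A\<close> needs
    this.\<close>
  have "transpose_mat G * (A * transpose_mat A) = 1\<^sub>m k"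
    using arg_cong[OF inverse, of transpose_mat] transpose_mult[OF AAt G] transpose_mult[OF A At]
    by simp
  then have "transpose_mat G * (A * transpose_mat A * G) = G"
    using assoc_mult_mat[of "transpose_mat G" k k "A * transpose_mat A" k G k] A G by simp
  then have G_sym: "transpose_mat G = G"
    unfolding inverse using G by simp
  show ?thesis
  proof (rule pinv_eqI[OF A X])
    show "A * (transpose_mat A * G) * A = A"
      unfolding AX using A by simp
    show "transpose_mat A * G * A * (transpose_mat A * G) = transpose_mat A * G"
      using assoc_mult_mat[OF X A X] right_mult_one_mat[OF X] AX by simp
    show "transpose_mat (A * (transpose_mat A * G)) = A * (transpose_mat A * G)"
      unfolding AX by simp
    have "transpose_mat (transpose_mat A * G * A) = transpose_mat A * (transpose_mat G * A)"
      using transpose_mult[OF X A] transpose_mult[OF At G] by simp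
    then show "transpose_mat (transpose_mat A * G * A) = transpose_mat A * G * A"
      unfolding G_sym using assoc_mult_mat[OF At G A] by simp
  qed
qed

section \<open>Rank one and rank two for matrices with two rows\<close>

definition two_rows :: "nat \<Rightarrow> (nat \<Rightarrow> real) \<Rightarrow> (nat \<Rightarrow> real) \<Rightarrow> real Matrix.mat"
  where "two_rows l p q = Matrix.mat 2 l (\<lambda>(i, j). if i = 0 then p j else q j)"

lemma two_rows_carrier: "two_rows l p q \<in> carrier_mat 2 l"
  by (simp add: two_rows_def)

lemma less_2_iff: "i < (2::nat) \<longleftrightarrow> i = 0 \<or> i = 1"
  by auto

lemma sum_less_2: "sum f {0..<2::nat} = f 0 + f 1"
  by (simp add: numeral_2_eq_2)

lemma vec_of_list_pair_carrier: "vec_of_list [s, t] \<in> carrier_vec 2"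
  by (simp only: carrier_dim_vec dim_vec_of_list list.size numeral_2_eq_2 plus_nat.add_0 add_0_right add_Suc_right One_nat_def)

text \<open>The case met for imaginary \<open>lam\<close>. Exhibiting the pseudo-inverse, the scaled
  transpose of the first row, gives the definite description in \<open>pinv\<close> a known
  dimension.\<close>

lemma pinv_two_rows_zero:
  assumes "(\<Sum>j<l. (p j)\<^sup>2) \<noteq> 0"
  shows "pinv (two_rows l p (\<lambda>_. 0)) \<in> carrier_mat l 2"
proof -
  define a where "a = (\<Sum>j<l. (p j)\<^sup>2)"
  define X where "X = Matrix.mat l 2 (\<lambda>(j, i). if i = 0 then p j / a else 0)"
  have a: "(\<Sum>j = 0..<l. p j * p j / a) = 1"
    using assms by (simp add: a_def power2_eq_square atLeast0LessThan flip: sum_divide_distrib)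
  let ?A = "two_rows l p (\<lambda>_. 0)"
  define Q :: "real Matrix.mat" where "Q = Matrix.mat 2 2 (\<lambda>(i, j). if i = 0 \<and> j = 0 then 1 else 0)"
  have AX: "?A * X = Q"
    by (rule eq_matI) (auto simp: two_rows_def X_def Q_def scalar_prod_def a less_2_iff)
  have "pinv ?A = X"
  proof (rule pinv_eqI[OF two_rows_carrier])
    show X: "X \<in> carrier_mat l 2" by (simp add: X_def)
    show "?A * X * ?A = ?A"
      unfolding AX
      by (rule eq_matI) (auto simp: two_rows_def Q_def scalar_prod_def less_2_iff sum_less_2)
    have "X * Q = X"
      by (rule eq_matI) (auto simp: X_def Q_def scalar_prod_def less_2_iff sum_less_2)
    then show "X * ?A * X = X"
      using assoc_mult_mat[OF X two_rows_carrier X] AX by simp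
    show "transpose_mat (?A * X) = ?A * X"
      unfolding AX by (rule eq_matI) (auto simp: Q_def)
    show "transpose_mat (X * ?A) = X * ?A"
      by (rule eq_matI) (auto simp: X_def two_rows_def scalar_prod_def sum_less_2)
  qed
  then show ?thesis by (simp add: X_def)
qed

text \<open>\<open>a\<close>, \<open>b\<close>, \<open>d\<close> are the entries of the Gram matrix,
  so \<open>det\<close> says that the rows are independent. The least norm solution lies in the row
  space, with coordinates \<open>g\<close> and \<open>h\<close>.\<close>

lemma pinv_two_rows_independent:
  fixes p q :: "nat \<Rightarrow> real" and l :: nat
  defines "a \<equiv> \<Sum>j<l. (p j)\<^sup>2" and "b \<equiv> \<Sum>j<l. p j * q j" and "d \<equiv> \<Sum>j<l. (q j)\<^sup>2"
  assumes det: "a * d - b\<^sup>2 \<noteq> 0"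
  obtains g h where "pinv (two_rows l p q) *\<^sub>v vec_of_list [s, t] \<in> carrier_vec l"
    and "\<And>j. j < l \<Longrightarrow> vec_index (pinv (two_rows l p q) *\<^sub>v vec_of_list [s, t]) j = g * p j + h * q j"
    and "a * g + b * h = s" and "b * g + d * h = t"
proof -
  define \<Delta> where "\<Delta> = a * d - b\<^sup>2"
  \<comment> \<open>Cramer's rule for the Gram system with right-hand side
    \<open>(s, t)\<close>.\<close>
  define g h where "g = (d * s - b * t) / \<Delta>" and "h = (a * t - b * s) / \<Delta>"
  define G where "G = Matrix.mat 2 2 (\<lambda>(i, j). if i = j then (if i = 0 then d else a) / \<Delta> else - b / \<Delta>)"
  let ?A = "two_rows l p q"
  have gram: "?A * transpose_mat ?A
      = Matrix.mat 2 2 (\<lambda>(i, j). if i = j then if i = 0 then a else d else b)"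
    by (rule eq_matI)
      (auto simp: two_rows_def scalar_prod_def less_2_iff a_def b_def d_def power2_eq_square
        atLeast0LessThan mult.commute)
  have \<Delta>: "\<Delta> \<noteq> 0" "a * d = \<Delta> + b * b"
    using det by (simp_all add: \<Delta>_def power2_eq_square)
  have "?A * transpose_mat ?A * G = 1\<^sub>m 2"
    unfolding gram using \<Delta>
    by (intro eq_matI) (auto simp: G_def scalar_prod_def less_2_iff sum_less_2 field_simps)
  then have pinv: "pinv ?A = transpose_mat ?A * G"
    by (intro pinv_full_row_rank[OF two_rows_carrier]) (simp_all add: G_def)
  have G_carrier: "G \<in> carrier_mat 2 2"
    by (simp add: G_def)
  have "G *\<^sub>v vec_of_list [s, t] = vec_of_list [g, h]"
  proof (rule eq_vecI)
    fix i assume "i < dim_vec (vec_of_list [g, h])"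
    then have "i = 0 \<or> i = 1" by auto
    then show "vec_index (G *\<^sub>v vec_of_list [s, t]) i = vec_index (vec_of_list [g, h]) i"
      by (auto simp: G_def g_def h_def scalar_prod_def vec_of_list_index numeral_2_eq_2
          diff_divide_distrib simp del: vec_of_list_Cons)
  qed (simp add: G_def)
  moreover have "transpose_mat ?A \<in> carrier_mat l 2"
    using two_rows_carrier[of l p q] by simp
  moreover have "vec_of_list [s, t] \<in> carrier_vec 2"
    by (rule vec_of_list_pair_carrier)
  ultimately have solution:
    "pinv ?A *\<^sub>v vec_of_list [s, t] = transpose_mat ?A *\<^sub>v vec_of_list [g, h]"
    unfolding pinv using G_carrier by (metis assoc_mult_mat_vec)
  show ?thesis
  proof (rule that[of g h])
    show "pinv ?A *\<^sub>v vec_of_list [s, t] \<in> carrier_vec l"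
      unfolding solution using two_rows_carrier[of l p q]
      by (intro mult_mat_vec_carrier[of _ l 2] vec_of_list_pair_carrier) simp
    show "vec_index (pinv ?A *\<^sub>v vec_of_list [s, t]) j = g * p j + h * q j" if "j < l" for j
      unfolding solution using that two_rows_carrier[of l p q]
      by (subst index_mult_mat_vec) (simp_all add: two_rows_def scalar_prod_def vec_of_list_index
          numeral_2_eq_2 del: vec_of_list_Cons)
    have cramer: "\<Delta> * g = d * s - b * t" "\<Delta> * h = a * t - b * s"
      using \<Delta>(1) by (simp_all add: g_def h_def)
    have "\<Delta> * (a * g + b * h) = a * (\<Delta> * g) + b * (\<Delta> * h)"
      by (simp only: distrib_left mult.left_commute)
    also have "\<dots> = \<Delta> * s"
      unfolding cramer by (simp add: \<Delta>_def algebra_simps power2_eq_square)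
    finally show "a * g + b * h = s" using \<Delta>(1) by simp
    have "\<Delta> * (b * g + d * h) = b * (\<Delta> * g) + d * (\<Delta> * h)"
      by (simp only: distrib_left mult.left_commute)
    also have "\<dots> = \<Delta> * t"
      unfolding cramer by (simp add: \<Delta>_def algebra_simps power2_eq_square)
    finally show "b * g + d * h = t" using \<Delta>(1) by simp
  qed
qed

text \<open>The coefficient of \<open>t j\<close> in the real linear system that defines \<^const>\<open>r_hat\<close>.\<close>

definition graded_power :: "complex \<Rightarrow> nat \<Rightarrow> complex"
  where "graded_power z j = z ^ j * (if even j then 1 else \<i>)"

text \<open>For odd \<open>j\<close> the factor \<open>\<i>\<close> turns the real part into
  \<open>- Im (z ^ j)\<close> and the imaginary part into \<open>Re (z ^ j)\<close>. This accounts
  for the signs and index projections in \<open>r_hat\<close>.\<close>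

lemma r_hat_eq:
  "r_hat m z s = pinv (two_rows (m + 1) (\<lambda>j. Re (graded_power z j)) (\<lambda>j. Im (graded_power z j)))
    *\<^sub>v vec_of_list [Re s, Im s]"
proof -
  have "mat_of_rows (m + 1)
      [even_proj (map_vec Re (Lambda_vec m z)) - odd_proj (map_vec Im (Lambda_vec m z)),
       even_proj (map_vec Im (Lambda_vec m z)) + odd_proj (map_vec Re (Lambda_vec m z))]
    = two_rows (m + 1) (\<lambda>j. Re (graded_power z j)) (\<lambda>j. Im (graded_power z j))"
    by (rule eq_matI)
      (auto simp: mat_of_rows_def two_rows_def even_proj_def odd_proj_def Lambda_vec_def
        graded_power_def less_2_iff)
  then show ?thesis by (simp add: r_hat_def Let_def)
qed

section \<open>The vector \<open>r_hat\<close> on and off the imaginary axis\<close>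

lemma cnj_imaginary_power: "Re z = 0 \<Longrightarrow> cnj (z ^ j) = (-1) ^ j * z ^ j"
proof -
  assume "Re z = 0"
  then have "cnj z = - z" by (simp add: complex_eq_iff)
  then show ?thesis by (metis complex_cnj_power power_minus)
qed

text \<open>All graded powers are real, so the second row vanishes, while the entry \<open>1\<close>
  at index \<open>0\<close> keeps the first row nonzero.\<close>

lemma r_hat_imaginary:
  assumes "Re z = 0"
  shows "r_hat m z s \<in> carrier_vec (m + 1)"
proof -
  have "cnj (graded_power z j) = graded_power z j" for j
    using cnj_imaginary_power[OF assms, of j] by (simp add: graded_power_def)
  then have im: "(\<lambda>j. Im (graded_power z j)) = (\<lambda>_. 0)"
    by (simp add: complex_eq_iff fun_eq_iff)
  have "(Re (graded_power z 0))\<^sup>2 \<le> (\<Sum>j<m + 1. (Re (graded_power z j))\<^sup>2)"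
    by (rule member_le_sum) auto
  then have "(\<Sum>j<m + 1. (Re (graded_power z j))\<^sup>2) \<noteq> 0"
    by (simp add: graded_power_def)
  from mult_mat_vec_carrier[OF pinv_two_rows_zero[OF this] vec_of_list_pair_carrier] show ?thesis
    unfolding r_hat_eq im .
qed

lemma r_hat_not_imaginary:
  assumes "Re z \<noteq> 0" and "m \<ge> 1"
  obtains \<gamma> where "r_hat m z s \<in> carrier_vec (m + 1)"
    and "\<And>j. j \<le> m \<Longrightarrow> vec_index (r_hat m z s) j = Re (\<gamma> * graded_power z j)"
    and "(\<Sum>j\<le>m. graded_power z j * complex_of_real (vec_index (r_hat m z s) j)) = s"
proof -
  let ?p = "\<lambda>j. Re (graded_power z j)" and ?q = "\<lambda>j. Im (graded_power z j)"
  define a where "a = (\<Sum>j<m + 1. (?p j)\<^sup>2)"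
  define b where "b = (\<Sum>j<m + 1. ?p j * ?q j)"
  define d where "d = (\<Sum>j<m + 1. (?q j)\<^sup>2)"
  have "(?p 0)\<^sup>2 \<le> a"
    unfolding a_def by (rule member_le_sum) auto
  then have a: "a > 0" by (simp add: graded_power_def)
  have det: "a * d - b\<^sup>2 \<noteq> 0"
  proof
    assume "a * d - b\<^sup>2 = 0"
    \<comment> \<open>The Gram determinant times \<open>a\<close> is a sum of squares, so its
      vanishing would make the rows proportional.\<close>
    have "(\<Sum>j<m + 1. (a * ?q j - b * ?p j)\<^sup>2)
        = (\<Sum>j<m + 1. a\<^sup>2 * (?q j)\<^sup>2 + b\<^sup>2 * (?p j)\<^sup>2 - 2 * a * b * (?p j * ?q j))"
      by (intro sum.cong) (simp_all add: power2_diff power_mult_distrib)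
    also have "\<dots> = a\<^sup>2 * d + b\<^sup>2 * a - 2 * a * b * b"
      unfolding sum.distrib sum_subtractf sum_distrib_left[symmetric]
      by (simp only: a_def b_def d_def)
    also have "\<dots> = a * (a * d - b\<^sup>2)"
      by (simp add: algebra_simps power2_eq_square)
    finally have "(\<Sum>j<m + 1. (a * ?q j - b * ?p j)\<^sup>2) = 0"
      using \<open>a * d - b\<^sup>2 = 0\<close> by simp
    then have zero: "a * ?q j - b * ?p j = 0" if "j < m + 1" for j
      using that by (subst (asm) sum_nonneg_eq_0_iff) auto
    \<comment> \<open>Column \<open>0\<close> is \<open>(1, 0)\<close>, which forces
      \<open>b = 0\<close>. Column \<open>1\<close>, present because \<open>m \<ge> 1\<close>, has
      second entry \<open>Re z\<close>, so \<open>a * Re z = 0\<close>.\<close>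
    have "b = 0" using zero[of 0] by (simp add: graded_power_def)
    then show False
      using zero[of 1] a assms by (simp add: graded_power_def)
  qed
  obtain g h where gh: "r_hat m z s \<in> carrier_vec (m + 1)"
    "\<And>j. j < m + 1 \<Longrightarrow> vec_index (r_hat m z s) j = g * ?p j + h * ?q j"
    "a * g + b * h = Re s" "b * g + d * h = Im s"
    using det pinv_two_rows_independent[of ?p "m + 1" ?q "Re s" "Im s",
        folded a_def b_def d_def r_hat_eq[of m z s]] by blast
  show ?thesis
  proof
    show "r_hat m z s \<in> carrier_vec (m + 1)" by fact
    \<comment> \<open>The multiplier is chosen so that
      \<open>Re (\<gamma> * v) = g * Re v + h * Im v\<close>.\<close>
    show "vec_index (r_hat m z s) j = Re (Complex g (- h) * graded_power z j)" if "j \<le> m" for j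
      using gh(2)[of j] that by simp
    have "(\<Sum>j<m + 1. ?p j * vec_index (r_hat m z s) j) = a * g + b * h"
      unfolding a_def b_def sum_distrib_right sum.distrib[symmetric]
      by (intro sum.cong) (simp_all add: gh(2) algebra_simps power2_eq_square)
    moreover have "(\<Sum>j<m + 1. ?q j * vec_index (r_hat m z s) j) = b * g + d * h"
      unfolding d_def b_def sum_distrib_right sum.distrib[symmetric]
      by (intro sum.cong) (simp_all add: gh(2) algebra_simps power2_eq_square)
    ultimately show "(\<Sum>j\<le>m. graded_power z j * complex_of_real (vec_index (r_hat m z s) j)) = s"
      unfolding gh by (simp add: complex_eq_iff flip: lessThan_Suc_atMost)
  qed
qed

section \<open>Structured backward errors\<close>

lemma cscale_minus: "(- c) *\<^sub>C A = - (c *\<^sub>C A)"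
  by (simp add: vec_eq_iff cscale_def)

lemma matrix_mult_outer: "A ** outer u v = outer (A *v u) v"
  by (simp add: vec_eq_iff matrix_matrix_mult_def outer_def matrix_vector_mult_def
      sum_distrib_left sum_distrib_right mult_ac)

lemma outer_mult_matrix: "outer u v ** A = outer u (conj_transpose A *v v)"
  by (simp add: vec_eq_iff matrix_matrix_mult_def outer_def matrix_vector_mult_def
      conj_transpose_def sum_distrib_left sum_distrib_right mult_ac)

lemma conj_transpose_mat_1: "conj_transpose (mat 1) = mat 1"
  by (simp add: conj_transpose_def mat_def vec_eq_iff)

text \<open>\<open>Px\<close> is Hermitian and maps \<open>r\<close> to \<open>w\<close>; this turns
  the stated coefficients into the outer products of \<open>coef\<close>.\<close>

lemma complement_projection_products:
  fixes x r :: "complex^'n"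
  defines "Px \<equiv> mat 1 - outer x x" and "w \<equiv> r - hprod x r *s x"
  shows "Px ** outer r x = outer w x" "outer x r ** Px = outer x w"
    "Px ** outer r r ** Px = outer w w"
proof -
  have Px: "conj_transpose Px = Px" "Px *v r = w"
    by (simp_all add: Px_def w_def conj_transpose_simps conj_transpose_mat_1
        matrix_vector_mult_diff_rdistrib matrix_vector_mult_outer)
  show "Px ** outer r x = outer w x" "outer x r ** Px = outer x w"
    "Px ** outer r r ** Px = outer w w"
    by (simp_all add: matrix_mult_outer outer_mult_matrix Px)
qed

text \<open>The sign from conjugating \<open>z ^ j\<close> cancels the sign from the grading of the
  coefficient.\<close>

lemma H_even_quadratic_form_real:
  assumes "P \<in> H_even m" "Re z = 0"
  shows "cnj (hprod x (mp_eval P z *v x)) = hprod x (mp_eval P z *v x)"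
proof -
  have P: "P \<in> matrix_polys m" "\<And>j. j \<le> m \<Longrightarrow> conj_transpose (coeff P j) = (-1) ^ j *\<^sub>C coeff P j"
    using assms(1) by (simp_all add: H_even_iff)
  have "cnj (z ^ j * hprod x (coeff P j *v x)) = z ^ j * hprod x (coeff P j *v x)" if "j \<le> m" for j
    unfolding complex_cnj_mult cnj_imaginary_power[OF assms(2)]
    by (subst (2) hprod_graded_hermitian[OF P(2)[OF that]]) (simp add: mult_ac)
  then show ?thesis
    by (simp add: mp_eval_mult_vec[OF P(1)] hprod_sum_right hprod_scale_right del: complex_cnj_mult)
qed

theorem theorem3p14:
  fixes m :: nat
    and P DF D2 :: "(complex^'n^'n) poly"
    and lam :: complex
    and x r :: "complex^'n"
    and Px :: "complex^'n^'n"
    and L :: real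
    and rh :: "real Matrix.vec"
    and E F AF A2 :: "nat \<Rightarrow> complex^'n^'n"
  assumes m: "m \<ge> 1"
    and P: "P \<in> H_even m" "mp_regular P"
    and x: "hprod x x = 1"
    and r: "r = - (mp_eval P lam *v x)"
    and Px: "Px = mat 1 - outer x x"
    and L: "L = l2norm (Lambda_vec m lam)"
    and rh: "rh = r_hat m lam (hprod x r)"
    and E: "\<And>j. E j = complex_of_real (1 / L\<^sup>2) *\<^sub>C
              (cnj (lam ^ j) *\<^sub>C (Px ** outer r x) + lam ^ j *\<^sub>C (outer x r ** Px))"
    and F: "\<And>j. F j = complex_of_real (1 / L\<^sup>2) *\<^sub>C
              (cnj (lam ^ j) *\<^sub>C (Px ** outer r x) - lam ^ j *\<^sub>C (outer x r ** Px))"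
    and AF: "\<And>j. AF j =
          (if Re lam = 0 then
             (cnj (lam ^ j) / complex_of_real (L\<^sup>2)) *\<^sub>C
               (outer x r + outer r x - hprod r x *\<^sub>C outer x x)
           else if even j then complex_of_real (vec_index rh j) *\<^sub>C outer x x + E j
           else (\<i> * complex_of_real (vec_index rh j)) *\<^sub>C outer x x + F j)"
    and A2: "\<And>j. A2 j =
          (if Re lam = 0 then
             (cnj (lam ^ j) / complex_of_real (L\<^sup>2)) *\<^sub>C
               (outer x r + outer r x - hprod r x *\<^sub>C outer x x)
             + (if cmod (hprod x r) = norm r then 0
                else ((-1) ^ (j + 1) * lam ^ j * hprod x r
                       / complex_of_real (L\<^sup>2 * ((norm r)\<^sup>2 - (cmod (hprod x r))\<^sup>2)))
                     *\<^sub>C (Px ** outer r r ** Px))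
           else if even j then
             complex_of_real (vec_index rh j) *\<^sub>C outer x x + E j
             + (if cmod (hprod x r) = norm r then 0
                else ((-1) ^ (j + 1) * complex_of_real (vec_index rh j)
                       / complex_of_real ((norm r)\<^sup>2 - (cmod (hprod x r))\<^sup>2))
                     *\<^sub>C (Px ** outer r r ** Px))
           else
             (\<i> * complex_of_real (vec_index rh j)) *\<^sub>C outer x x + F j
             - (if cmod (hprod x r) = norm r then 0
                else (\<i> * (-1) ^ (j + 1) * complex_of_real (vec_index rh j)
                       / complex_of_real ((norm r)\<^sup>2 - (cmod (hprod x r))\<^sup>2))
                     *\<^sub>C (Px ** outer r r ** Px)))"
    and DF: "DF = (\<Sum>j\<le>m. monom (AF j) j)"
    and D2: "D2 = (\<Sum>j\<le>m. monom (A2 j) j)"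
  shows
    "rh \<in> carrier_vec (m + 1)
     \<and> (Re lam = 0 \<longrightarrow>
          structured_error (H_even m) m Frobenius lam x P
            = sqrt (2 * (norm r)\<^sup>2 - (cmod (hprod x r))\<^sup>2) / L
          \<and> (\<forall>M. sqrt (2 * (norm r)\<^sup>2 - (cmod (hprod x r))\<^sup>2) / L
                   \<le> sqrt 2 * unstructured_error m M lam x P))
     \<and> (Re lam \<noteq> 0 \<longrightarrow>
          structured_error (H_even m) m Frobenius lam x P
            = sqrt ((l2norm rh)\<^sup>2 + 2 * ((norm r)\<^sup>2 - (cmod (hprod x r))\<^sup>2) / L\<^sup>2))
     \<and> (Re lam = 0 \<longrightarrow>
          (\<forall>M. structured_error (H_even m) m Spectral lam x P = unstructured_error m M lam x P))
     \<and> (Re lam \<noteq> 0 \<longrightarrow>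
          structured_error (H_even m) m Spectral lam x P
            = sqrt ((l2norm rh)\<^sup>2 + ((norm r)\<^sup>2 - (cmod (hprod x r))\<^sup>2) / L\<^sup>2))
     \<and> (DF \<in> H_even m
        \<and> mp_eval P lam *v x + mp_eval DF lam *v x = 0
        \<and> mp_norm m Frobenius DF = structured_error (H_even m) m Frobenius lam x P
        \<and> (\<forall>D \<in> H_even m. mp_eval P lam *v x + mp_eval D lam *v x = 0
             \<and> mp_norm m Frobenius D = structured_error (H_even m) m Frobenius lam x P
             \<longrightarrow> D = DF))
     \<and> (D2 \<in> H_even m
        \<and> mp_eval P lam *v x + mp_eval D2 lam *v x = 0
        \<and> mp_norm m Spectral D2 = structured_error (H_even m) m Spectral lam x P)"
proof -
  define s where "s = hprod x r"
  have L': "L = power_norm m lam" by (simp add: L l2norm_Lambda_vec)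
  have "L > 0" by (simp add: L' power_norm_pos)
  have unstructured: "unstructured_error m M lam x P = norm r / L" for M
    by (simp add: unstructured_error_eq[OF x] r L')
  show ?thesis
  proof (cases "Re lam = 0")
    case True
    \<comment> \<open>The Cauchy-Schwarz solution for the right-hand side \<open>s\<close>. As
      \<open>s\<close> is real, \<open>a\<close> is graded and
      \<open>cnj (a j) = \<gamma> * lam ^ j\<close>, so \<open>stationary\<close> holds for every
      \<open>b\<close>.\<close>
    define a where "a j = cnj (lam ^ j) * s / complex_of_real (L\<^sup>2)" for j
    define \<gamma> where "\<gamma> = cnj s / complex_of_real (L\<^sup>2)"
    have s_real: "cnj s = s"
      using H_even_quadratic_form_real[OF P(1) True, of x]
      by (simp add: s_def r hprod_def sum_negf)
    have cnj_a: "cnj (a j) = lam ^ j * s / complex_of_real (L\<^sup>2)" for j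
      by (simp add: a_def s_real)
    interpret minimal_coefficients m lam x r a \<gamma>
    proof
      show "hprod x x = 1" by (rule x)
      show "cnj (a j) = (-1) ^ j * a j" for j
        unfolding cnj_a unfolding a_def cnj_imaginary_power[OF True]
        by (simp flip: mult.assoc power_mult_distrib)
      have "(\<Sum>j\<le>m. lam ^ j * a j)
          = (\<Sum>j\<le>m. lam ^ j * (cnj (lam ^ j) / complex_of_real (L\<^sup>2))) * s"
        by (simp add: a_def sum_distrib_right mult.assoc)
      then show "(\<Sum>j\<le>m. lam ^ j * a j) = hprod x r"
        by (simp only: L' sum_cnj_power s_def mult_1)
      show "Re (cnj (a j) * b) = Re (\<gamma> * (lam ^ j * b))" for j b
        unfolding cnj_a \<gamma>_def s_real by (rule arg_cong[of _ _ Re]) (simp add: mult_ac)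
    qed
    define c where "c j = (-1) ^ (j + 1) * cnj (a j) / complex_of_real ((norm w)\<^sup>2)" for j
    \<comment> \<open>For imaginary \<open>lam\<close> sign and conjugation cancel, so
      \<open>w x^H\<close> and \<open>x w^H\<close> carry the same scalar.\<close>
    have mu: "\<mu> j = cnj (lam ^ j) / complex_of_real (L\<^sup>2)"
      "(-1) ^ j * cnj (\<mu> j) = cnj (lam ^ j) / complex_of_real (L\<^sup>2)" for j
      using cnj_imaginary_power[OF True, of j] by (simp_all add: \<mu>_def L')
    have r_split: "r = w + s *s x" by (simp add: w_def s_def)
    have AF': "AF j = coef (\<lambda>_. 0) j" for j
    proof -
      have split: "outer x r + outer r x - hprod r x *\<^sub>C outer x x
          = s *\<^sub>C outer x x + outer w x + outer x w"
        unfolding cnj_hprod[of x r, symmetric] s_def[symmetric] s_real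
        by (subst (1 2) r_split)
          (simp add: vec_eq_iff outer_def cscale_def algebra_simps s_real)
      show ?thesis
        using True unfolding AF split coef_def mu(2) unfolding mu(1) a_def by (simp add: cscale_simps)
    qed
    have w_zero: "w = 0" if "cmod (hprod x r) = norm r"
      using norm_w that by simp
    have A2': "A2 j = coef c j" for j
    proof -
      have "coef c j = coef (\<lambda>_. 0) j + c j *\<^sub>C outer w w"
        by (simp add: coef_def cscale_simps)
      \<comment> \<open>In the exceptional case \<open>w = 0\<close>, so the right-hand side is
        \<open>0\<close> too.\<close>
      moreover have "(if cmod (hprod x r) = norm r then 0
          else ((-1) ^ (j + 1) * lam ^ j * hprod x r
            / complex_of_real (L\<^sup>2 * ((norm r)\<^sup>2 - (cmod (hprod x r))\<^sup>2)))
            *\<^sub>C (Px ** outer r r ** Px)) = c j *\<^sub>C outer w w"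
        unfolding Px complement_projection_products w_def[symmetric] norm_w[symmetric]
          c_def cnj_a s_def
        using w_zero by (auto simp: cscale_simps mult_ac)
      ultimately show ?thesis
        using True unfolding A2 AF'[symmetric] AF by (simp only: simp_thms if_True)
    qed
    note DF' = DF[unfolded AF'] and D2' = D2[unfolded A2']
    have sum_a: "(\<Sum>j\<le>m. (cmod (a j))\<^sup>2) = (cmod s)\<^sup>2 / L\<^sup>2"
    proof -
      have "(\<Sum>j\<le>m. (cmod (a j))\<^sup>2) = (power_norm m lam)\<^sup>2 * (cmod s / L\<^sup>2)\<^sup>2"
        unfolding power_norm_squared
        by (simp add: a_def norm_mult norm_divide norm_power power_divide power_mult_distrib
            sum_distrib_right sum_divide_distrib)
      then show ?thesis
        using \<open>L > 0\<close>
        by (simp add: L' power_divide power2_eq_square)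
    qed
    have frob: "structured_error (H_even m) m Frobenius lam x P
        = sqrt (2 * (norm r)\<^sup>2 - (cmod (hprod x r))\<^sup>2) / L"
    proof -
      have "(\<Sum>j\<le>m. (cmod (a j))\<^sup>2) + 2 * ((norm w)\<^sup>2 / (power_norm m lam)\<^sup>2)
          = (2 * (norm r)\<^sup>2 - (cmod (hprod x r))\<^sup>2) / L\<^sup>2"
        unfolding sum_a norm_w L' s_def by (simp add: diff_divide_distrib)
      then show ?thesis
        using \<open>L > 0\<close>
        unfolding structured_error_frobenius[OF r DF'] mp_norm_frobenius_minimizer[OF r DF']
        by (simp add: real_sqrt_divide)
    qed
    have spec: "structured_error (H_even m) m Spectral lam x P = norm r / L"
    proof -
      have "(\<Sum>j\<le>m. (cmod (a j))\<^sup>2) + (norm w)\<^sup>2 / (power_norm m lam)\<^sup>2 = (norm r)\<^sup>2 / L\<^sup>2"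
        unfolding sum_a norm_w L' s_def by (simp add: diff_divide_distrib)
      then show ?thesis
        using \<open>L > 0\<close>
        unfolding structured_error_spectral[OF r c_def D2'] mp_norm_spectral_minimizer[OF r c_def D2']
        by (simp add: real_sqrt_divide)
    qed
    have "sqrt (2 * (norm r)\<^sup>2 - (cmod (hprod x r))\<^sup>2) \<le> sqrt (2 * (norm r)\<^sup>2)"
      by (rule real_sqrt_le_mono) simp
    then have bound: "sqrt (2 * (norm r)\<^sup>2 - (cmod (hprod x r))\<^sup>2) / L \<le> sqrt 2 * (norm r / L)"
      using \<open>L > 0\<close> by (simp add: real_sqrt_mult divide_right_mono)
    have "rh \<in> carrier_vec (m + 1)"
      unfolding rh by (rule r_hat_imaginary[OF True])
    then show ?thesis
      using True frob spec bound frobenius_minimizer[OF r DF'] spectral_minimizer[OF r c_def D2']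
      unfolding unstructured by blast
  next
    case False
    obtain \<gamma> where rh_carrier: "rh \<in> carrier_vec (m + 1)"
      and rh_entry: "\<And>j. j \<le> m \<Longrightarrow> vec_index rh j = Re (\<gamma> * graded_power lam j)"
      and rh_sum: "(\<Sum>j\<le>m. graded_power lam j * complex_of_real (vec_index rh j)) = hprod x r"
      unfolding rh using r_hat_not_imaginary[OF False m] by metis
    \<comment> \<open>The real solution times \<open>1\<close> or \<open>\<i>\<close>, as the
      grading demands.\<close>
    define a where "a j = (if even j then 1 else \<i>) * complex_of_real (vec_index rh j)" for j
    interpret minimal_coefficients m lam x r a \<gamma>
    proof
      show "hprod x x = 1" by (rule x)
      show "cnj (a j) = (-1) ^ j * a j" for j
        by (simp add: a_def)
      show "(\<Sum>j\<le>m. lam ^ j * a j) = hprod x r"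
        using rh_sum by (simp add: a_def graded_power_def mult_ac)
      show "Re (cnj (a j) * b) = Re (\<gamma> * (lam ^ j * b))"
        if "j \<le> m" "cnj b = (-1) ^ j * b" for j b
      proof -
        \<comment> \<open>The symmetry of \<open>b\<close> makes it a real multiple of
          \<open>1\<close> or \<open>\<i>\<close>; stationarity then reduces to the row-space form
          of \<open>rh\<close>.\<close>
        define t where "t = (if even j then Re b else Im b)"
        have b: "b = (if even j then 1 else \<i>) * complex_of_real t"
          using that(2) by (auto simp: t_def complex_eq_iff)
        have "Re (cnj (a j) * b) = vec_index rh j * t"
          by (simp add: a_def b)
        also have "\<dots> = Re (\<gamma> * graded_power lam j * complex_of_real t)"
          unfolding rh_entry[OF that(1)]
          by (simp only: times_complex.sel(1) Re_complex_of_real Im_complex_of_real mult_zero_right diff_0_right)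
        also have "\<gamma> * graded_power lam j * complex_of_real t = \<gamma> * (lam ^ j * b)"
          by (simp add: b graded_power_def)
        finally show ?thesis .
      qed
    qed
    define c where "c j = (-1) ^ (j + 1) * cnj (a j) / complex_of_real ((norm w)\<^sup>2)" for j
    have mu: "\<mu> j = complex_of_real (1 / L\<^sup>2) * cnj (lam ^ j)"
      "cnj (\<mu> j) = complex_of_real (1 / L\<^sup>2) * lam ^ j" for j
      by (simp_all add: \<mu>_def L')
    have AF': "AF j = coef (\<lambda>_. 0) j" for j
      using False
      unfolding AF E F Px complement_projection_products w_def[symmetric] coef_def mu a_def
      by (simp add: cscale_simps cscale_minus)
    have w_zero: "w = 0" if "cmod (hprod x r) = norm r"
      using norm_w that by simp
    have A2': "A2 j = coef c j" for j
    proof -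
      have "coef c j = coef (\<lambda>_. 0) j + c j *\<^sub>C outer w w"
        by (simp add: coef_def cscale_simps)
      \<comment> \<open>The subtraction for odd \<open>j\<close> in \<open>A2\<close> comes from
        \<open>cnj \<i> = - \<i>\<close> in \<open>c j\<close>.\<close>
      moreover have "A2 j = AF j + c j *\<^sub>C outer w w"
        using False w_zero
        unfolding A2 AF Px complement_projection_products w_def[symmetric] norm_w[symmetric] c_def a_def
        by (auto simp: cscale_simps cscale_minus)
      ultimately show ?thesis by (simp add: AF')
    qed
    note DF' = DF[unfolded AF'] and D2' = D2[unfolded A2']
    have "cmod (a j) = \<bar>vec_index rh j\<bar>" for j
      by (simp add: a_def norm_mult)
    then have sum_a: "(\<Sum>j\<le>m. (cmod (a j))\<^sup>2) = (l2norm rh)\<^sup>2"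
      using rh_carrier by (simp add: l2norm_def sum_nonneg flip: lessThan_Suc_atMost)
    have frob: "structured_error (H_even m) m Frobenius lam x P
        = sqrt ((l2norm rh)\<^sup>2 + 2 * ((norm r)\<^sup>2 - (cmod (hprod x r))\<^sup>2) / L\<^sup>2)"
      unfolding structured_error_frobenius[OF r DF'] mp_norm_frobenius_minimizer[OF r DF']
        sum_a norm_w L' by simp
    have spec: "structured_error (H_even m) m Spectral lam x P
        = sqrt ((l2norm rh)\<^sup>2 + ((norm r)\<^sup>2 - (cmod (hprod x r))\<^sup>2) / L\<^sup>2)"
      unfolding structured_error_spectral[OF r c_def D2'] mp_norm_spectral_minimizer[OF r c_def D2']
        sum_a norm_w L' by simp
    show ?thesis
      using False rh_carrier frob spec
        frobenius_minimizer[OF r DF'] spectral_minimizer[OF r c_def D2']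
      by blast
  qed
qed

end
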